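(* Let $F_i$ denote the Fibonacci numbers ($F_1=F_2=1$, $F_i=F_{i-1}+F_{i-2}$ for $i\ge 3$). Let $k\ge 3$ and let $(a_k,a_{k-1},\dots,a_1)\in\{-1,0,1\}^k$ satisfy $\sum_{i=1}^k a_iF_i=0$. Then $(a_k,a_{k-1})\notin\{(1,0),(1,1),(-1,0),(-1,-1)\}$ and $(a_k,a_{k-1},a_{k-2})\notin\{(1,-1,1),(-1,1,-1)\}$.
   Context: In the paper's terminology, such a sequence is a representation of $0$ of length $k$ using digits $\{1,0,T\}$ with $T=-1$, and it "starts with" $(b_1,\dots,b_r)$ if $a_{k-i+1}=b_i$ for $1\le i\le r$. *)

theory Defs
  imports "HOL-Number_Theory.Fib"
begin

end

theory Submission
  imports Defs
begin

text \<open>Since \<open>F\<^sub>1 + \<dots> + F\<^sub>n = F\<^bsub>n+2\<^esub> - 1\<close>, the lower digits contribute less than \<open>F\<^bsub>n+2\<^esub>\<close>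
  in absolute value, so they cannot cancel any of the listed leading patterns.\<close>

lemma abs_sum_fib_less:
  fixes a :: "nat \<Rightarrow> int"
  assumes "\<forall>i\<in>{1..n}. \<bar>a i\<bar> \<le> 1"
  shows "\<bar>\<Sum>i = 1..n. a i * int (fib i)\<bar> < int (fib (n + 2))"
  using assms
proof (induction n)
  case 0
  then show ?case by simp
next
  case (Suc n)
  have "\<bar>a (Suc n) * int (fib (Suc n))\<bar> \<le> 1 * int (fib (Suc n))"
    unfolding abs_mult using Suc.prems by (intro mult_mono) auto
  moreover have "\<bar>\<Sum>i = 1..n. a i * int (fib i)\<bar> < int (fib (n + 2))"
    using Suc by simp
  \<comment> \<open>The two bounds add up exactly, as
    \<open>fib (n + 3) = fib (n + 2) + fib (n + 1)\<close>.\<close>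
  ultimately show ?case by simp
qed

theorem theorem2p1:
  fixes k :: nat and a :: "nat \<Rightarrow> int"
  assumes "k \<ge> 3"
    and "\<forall>i\<in>{1..k}. a i \<in> {-1, 0, 1}"
    and "(\<Sum>i = 1..k. a i * int (fib i)) = 0"
  shows "(a k, a (k - 1)) \<notin> {(1, 0), (1, 1), (-1, 0), (-1, -1)} \<and>
         (a k, a (k - 1), a (k - 2)) \<notin> {(1, -1, 1), (-1, 1, -1)}"
proof -
  obtain m where k: "k = Suc (Suc (Suc m))"
    using \<open>k \<ge> 3\<close> by (metis Suc_le_D numeral_3_eq_3 Suc_le_mono)
  have digit: "\<bar>a i\<bar> \<le> 1" if "i \<in> {1..k}" for i
    using assms(2) that by fastforce
  define R where "R n = (\<Sum>i = 1..n. a i * int (fib i))" for n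
  have bound: "\<bar>R n\<bar> < int (fib (n + 2))" if "n \<le> k" for n
    unfolding R_def using that digit by (intro abs_sum_fib_less) auto
  have R_Suc: "R (Suc n) = R n + a (Suc n) * int (fib (Suc n))" for n
    by (simp add: R_def)
  have "R k = 0"
    using assms(3) by (simp add: R_def)
  \<comment> \<open>As \<open>m + 3 = k\<close>, the second bound rules out the two-digit patterns,
    which contribute at least \<open>fib k\<close> in absolute value.\<close>
  moreover have "\<bar>R m\<bar> < int (fib (m + 2))" "\<bar>R (Suc m)\<bar> < int (fib (m + 3))"
    using bound[of m] bound[of "Suc m"] by (simp_all add: k numeral_3_eq_3)
  \<comment> \<open>The three-digit patterns contribute \<open>2 * fib (m + 1)\<close> up to sign.
    This is at least \<open>fib (m + 2) = fib (m + 1) + fib m\<close>, hence exceeds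
    \<bar>\<open>R m\<close>\<bar>.\<close>
  moreover have "fib m \<le> fib (Suc m)"
    by (rule fib_mono) simp
  ultimately show ?thesis
    by (auto simp: k R_Suc numeral_3_eq_3 numeral_2_eq_2)
qed

end
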